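(* Let $\pi=(\sigma_0,\tau_0),\dots,(\sigma_{|\pi|-1},\tau_{|\pi|-1})$ be a finite trace of arity $d$, let $\varphi$ be an STL$^*$ formula, let $0\le i\le|\pi|-1$ be a position index, let $\mathcal{E}$ be an environment, and let $r\in\mathbb{R}$. Let $\varphi'$ be the formula obtained from $\varphi$ as follows. First, all negations are removed from $\varphi$ by pushing them inward using $\neg(\varphi_1\wedge\varphi_2)\equiv\neg\varphi_1\vee\neg\varphi_2$, $\neg(\varphi_1\vee\varphi_2)\equiv\neg\varphi_1\wedge\neg\varphi_2$, $\neg\Box_I\varphi\equiv\Diamond_I\neg\varphi$, $\neg\Diamond_I\varphi\equiv\Box_I\neg\varphi$, $\neg(\varphi_1\,\mathcal{U}_I\,\varphi_2)\equiv\Box_I\neg\varphi_2\vee\big(\neg\varphi_2\,\mathcal{U}_I\,(\neg\varphi_1\wedge\neg\varphi_2)\big)$, and, at signal predicates and signal constraints, removing the negation by reversing the comparison operator (e.g. $\neg(f(\overline{s})>0)$ becomes $f(\overline{s})\le 0$). Then, writing $\bowtie_>\in\{>,\ge\}$ and $\bowtie_<\in\{<,\le\}$, every signal predicate and signal constraint is replaced as follows: $f(\overline{s})\bowtie_> 0$ by $f(\overline{s})\bowtie_> r$; $f(\overline{s})\bowtie_< 0$ by $f(\overline{s})\bowtie_< -r$; $f_1(\overline{s})\bowtie_> f_2(\overline{s_*})$ by $f_1(\overline{s})\bowtie_> f_2(\overline{s_*})+r$; $f_1(\overline{s})\bowtie_< f_2(\overline{s_*})$ by $f_1(\overline{s})\bowtie_<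 f_2(\overline{s_*})-r$. Then: (i) if $(\pi,i,\mathcal{E})\models\varphi'$ then $\rho(\varphi,\pi,i,\mathcal{E})\ge r$; and (ii) if $(\pi,i,\mathcal{E})\not\models\varphi'$ then $\rho(\varphi,\pi,i,\mathcal{E})\le r$.
   Context: A trace (signal) of arity $d\in\mathbb{N}_{>0}$ is a pair $(\sigma,\tau)$ with $\sigma=\sigma_0,\dots,\sigma_{|\pi|-1}\in(\mathbb{R}^d)^{|\pi|}$ and strictly increasing timestamps $\tau_0<\dots<\tau_{|\pi|-1}$ in $\mathbb{R}_+$; $\sigma_i^k$ is the $k$-th component of $\sigma_i$. STL$^*$ formulas over signal variables $s^1,\dots,s^d$ and freeze variables $s^k_*$ (possibly indexed $s^k_{*h}$ for several freezes of the same dimension, treated as distinct variables) are: signal predicates $f(\overline{s})\sim 0$, signal constraints $f_1(\overline{s})\sim f_2(\overline{s_*})$ (with $f,f_1,f_2$ arbitrary functions, $\sim\in\{<,>,\le,\ge\}$), $\neg\varphi$, $\varphi_1\wedge\varphi_2$, $\varphi_1\vee\varphi_2$, $\Box_I\varphi$, $\Diamond_I\varphi$, $\varphi_1\,\mathcal{U}_I\,\varphi_2$ with $I=[a,b]$, $a,b\ge0$, and $s^k_*.\varphi$. An environment $\mathcal{E}$ maps freeze variables to reals. Boolean semantics: $(\pi,i,\mathcal{E})\models f(\overline{s})\sim0$ iff $f(\overline{\sigma_i})\sim0$; $(\pi,i,\mathcal{E})\models f_1(\overline{s})\sim f_2(\overline{s_*})$ iff $f_1(\overline{\sigma_i})\sim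 f_2(\mathcal{E}(s^1_* ),\dots,\mathcal{E}(s^d_* ))$; Boolean connectives as usual; $\Diamond_{[a,b]}\varphi$ holds at $i$ iff some $j$ with $\tau_j\in\tau_i+[a,b]$ satisfies $\varphi$; $\Box_{[a,b]}\varphi$ iff all such $j$ satisfy $\varphi$; $\varphi_1\,\mathcal{U}_{[a,b]}\,\varphi_2$ iff there is $j\ge i$ with $\tau_j\in\tau_i+[a,b]$, $(\pi,j,\mathcal{E})\models\varphi_2$ and $(\pi,k,\mathcal{E})\models\varphi_1$ for all $i\le k<j$; $(\pi,i,\mathcal{E})\models s^k_*.\varphi$ iff $(\pi,i,\mathcal{E}[s^k_*:=\sigma^k_i])\models\varphi$. Robustness $\rho(\varphi,\pi,i,\mathcal{E})$: $\rho(f(\overline{s})\bowtie_>0)=f(\overline{\sigma_i})$; $\rho(f(\overline{s})\bowtie_<0)=-f(\overline{\sigma_i})$; $\rho(f_1(\overline{s})\bowtie_> f_2(\overline{s_*}))=f_1(\overline{\sigma_i})-f_2(\mathcal{E}(s^1_* ),\dots,\mathcal{E}(s^d_* ))$; $\rho(f_1(\overline{s})\bowtie_< f_2(\overline{s_*}))=f_2(\mathcal{E}(s^1_* ),\dots)-f_1(\overline{\sigma_i})$; $\rho(\neg\varphi)=-\rho(\varphi)$; $\wedge$ and $\vee$ give $\min$ and $\max$; $\rho(\Box_I\varphi,i)=\min_{\tau_j\in\tau_i+I}\rho(\varphi,j)$; $\rho(\Diamond_I\varphi,i)=\max_{\tau_j\in\tau_i+I}\rho(\varphi,j)$; $\rho(\varphi_1\mathcal{U}_I\varphi_2,i)=\max_{\tau_j\in\tau_i+I}\min\big(\rho(\varphi_2,j),\min_{\tau_k\in[\tau_i,\tau_j)}\rho(\varphi_1,k)\big)$;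 $\rho(s^k_*.\varphi,i,\mathcal{E})=\rho(\varphi,i,\mathcal{E}[s^k_*:=\sigma^k_i])$ (all with the same $\pi$ and $\mathcal{E}$ unless stated).
   Formalization: Part (ii) is false as written: the rule for ¬(φ1 U_[a,b] φ2) is not an equivalence when 0<a≤b. Part (ii) is proved assuming the rule is valid at the interval of each until it is applied to, i.e. a=0 or [a,b] empty; part (i) is unconditional. *)

theory Defs
  imports "HOL-Analysis.Analysis"
begin

text \<open>
  The arity is the cardinality of the finite index type \<open>'d\<close>. A freeze variable is a pair
  \<open>(k, h)\<close>: a dimension \<open>k\<close> and an index \<open>h\<close> that separates several freezes of the same
  dimension. The index type \<open>'h\<close> is an arbitrary finite type (one element gives one freeze
  variable per dimension), so that \<open>f2\<close> in a signal constraint has finitely many arguments.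
\<close>

type_synonym 'd trace = "((real ^ 'd) \<times> real) list"

type_synonym ('d, 'h) env = "'d \<times> 'h \<Rightarrow> real"

definition sig :: "('d::finite) trace \<Rightarrow> nat \<Rightarrow> real ^ 'd" where
  "sig \<pi> i = fst (\<pi> ! i)"

definition time :: "('d::finite) trace \<Rightarrow> nat \<Rightarrow> real" where
  "time \<pi> i = snd (\<pi> ! i)"

definition is_trace :: "('d::finite) trace \<Rightarrow> bool" where
  "is_trace \<pi> \<longleftrightarrow>
     (\<forall>i < length \<pi>. 0 \<le> time \<pi> i) \<and>
     (\<forall>i j. i < j \<and> j < length \<pi> \<longrightarrow> time \<pi> i < time \<pi> j)"

datatype cmp = Lt | Gt | Le | Ge

fun cmp_holds :: "cmp \<Rightarrow> real \<Rightarrow> real \<Rightarrow> bool" where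
  "cmp_holds Lt x y \<longleftrightarrow> x < y"
| "cmp_holds Gt x y \<longleftrightarrow> x > y"
| "cmp_holds Le x y \<longleftrightarrow> x \<le> y"
| "cmp_holds Ge x y \<longleftrightarrow> x \<ge> y"

fun cmp_neg :: "cmp \<Rightarrow> cmp" where
  "cmp_neg Lt = Ge"
| "cmp_neg Gt = Le"
| "cmp_neg Le = Gt"
| "cmp_neg Ge = Lt"

definition is_upper :: "cmp \<Rightarrow> bool" where
  "is_upper c \<longleftrightarrow> c \<in> {Gt, Ge}"

text \<open>
  \<open>Pred f c\<close> is the predicate \<open>f(s) c 0\<close>, \<open>Constr f1 c f2\<close> the constraint
  \<open>f1(s) c f2(s\<^sub>*)\<close>; the two real arguments of a temporal operator are the end points
  of its interval.
\<close>

datatype ('d::finite, 'h::finite) stl =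
    Pred "real ^ 'd \<Rightarrow> real" cmp
  | Constr "real ^ 'd \<Rightarrow> real" cmp "('d \<times> 'h \<Rightarrow> real) \<Rightarrow> real"
  | Neg "('d, 'h) stl"
  | And "('d, 'h) stl" "('d, 'h) stl"
  | Or "('d, 'h) stl" "('d, 'h) stl"
  | Box real real "('d, 'h) stl"
  | Dia real real "('d, 'h) stl"
  | Until real real "('d, 'h) stl" "('d, 'h) stl"
  | Freeze 'd 'h "('d, 'h) stl"

primrec wf_stl :: "('d::finite, 'h::finite) stl \<Rightarrow> bool" where
  "wf_stl (Pred f c) \<longleftrightarrow> True"
| "wf_stl (Constr f1 c f2) \<longleftrightarrow> True"
| "wf_stl (Neg \<phi>) \<longleftrightarrow> wf_stl \<phi>"
| "wf_stl (And \<phi> \<psi>) \<longleftrightarrow> wf_stl \<phi> \<and> wf_stl \<psi>"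
| "wf_stl (Or \<phi> \<psi>) \<longleftrightarrow> wf_stl \<phi> \<and> wf_stl \<psi>"
| "wf_stl (Box a b \<phi>) \<longleftrightarrow> 0 \<le> a \<and> 0 \<le> b \<and> wf_stl \<phi>"
| "wf_stl (Dia a b \<phi>) \<longleftrightarrow> 0 \<le> a \<and> 0 \<le> b \<and> wf_stl \<phi>"
| "wf_stl (Until a b \<phi> \<psi>) \<longleftrightarrow> 0 \<le> a \<and> 0 \<le> b \<and> wf_stl \<phi> \<and> wf_stl \<psi>"
| "wf_stl (Freeze k h \<phi>) \<longleftrightarrow> wf_stl \<phi>"

definition window :: "('d::finite) trace \<Rightarrow> nat \<Rightarrow> real \<Rightarrow> real \<Rightarrow> nat set" where
  "window \<pi> i a b = {j. j < length \<pi> \<and> time \<pi> j \<in> {time \<pi> i + a .. time \<pi> i + b}}"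

primrec sat :: "('d::finite) trace \<Rightarrow> nat \<Rightarrow> ('d, 'h::finite) env \<Rightarrow> ('d, 'h) stl \<Rightarrow> bool" where
  "sat \<pi> i E (Pred f c) \<longleftrightarrow> cmp_holds c (f (sig \<pi> i)) 0"
| "sat \<pi> i E (Constr f1 c f2) \<longleftrightarrow> cmp_holds c (f1 (sig \<pi> i)) (f2 E)"
| "sat \<pi> i E (Neg \<phi>) \<longleftrightarrow> \<not> sat \<pi> i E \<phi>"
| "sat \<pi> i E (And \<phi> \<psi>) \<longleftrightarrow> sat \<pi> i E \<phi> \<and> sat \<pi> i E \<psi>"
| "sat \<pi> i E (Or \<phi> \<psi>) \<longleftrightarrow> sat \<pi> i E \<phi> \<or> sat \<pi> i E \<psi>"
| "sat \<pi> i E (Box a b \<phi>) \<longleftrightarrow> (\<forall>j \<in> window \<pi> i a b. sat \<pi> j E \<phi>)"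
| "sat \<pi> i E (Dia a b \<phi>) \<longleftrightarrow> (\<exists>j \<in> window \<pi> i a b. sat \<pi> j E \<phi>)"
| "sat \<pi> i E (Until a b \<phi> \<psi>) \<longleftrightarrow>
     (\<exists>j \<in> window \<pi> i a b. i \<le> j \<and> sat \<pi> j E \<psi> \<and> (\<forall>k. i \<le> k \<and> k < j \<longrightarrow> sat \<pi> k E \<phi>))"
| "sat \<pi> i E (Freeze k h \<phi>) \<longleftrightarrow> sat \<pi> i (E((k, h) := sig \<pi> i $ k)) \<phi>"

text \<open>
  Robustness is extended real: an empty window gives \<open>\<infinity>\<close> for a minimum and \<open>-\<infinity>\<close> for a
  maximum. All index sets are finite, so on nonempty ones \<open>SUP\<close> and \<open>INF\<close> are maximum
  and minimum. In the clause for until the inner index set is empty when \<open>j = i\<close>.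
\<close>

primrec rob :: "('d::finite, 'h::finite) stl \<Rightarrow> 'd trace \<Rightarrow> nat \<Rightarrow> ('d, 'h) env \<Rightarrow> ereal" where
  "rob (Pred f c) \<pi> i E =
     ereal (if is_upper c then f (sig \<pi> i) else - f (sig \<pi> i))"
| "rob (Constr f1 c f2) \<pi> i E =
     ereal (if is_upper c then f1 (sig \<pi> i) - f2 E else f2 E - f1 (sig \<pi> i))"
| "rob (Neg \<phi>) \<pi> i E = - rob \<phi> \<pi> i E"
| "rob (And \<phi> \<psi>) \<pi> i E = min (rob \<phi> \<pi> i E) (rob \<psi> \<pi> i E)"
| "rob (Or \<phi> \<psi>) \<pi> i E = max (rob \<phi> \<pi> i E) (rob \<psi> \<pi> i E)"
| "rob (Box a b \<phi>) \<pi> i E = (INF j \<in> window \<pi> i a b. rob \<phi> \<pi> j E)"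
| "rob (Dia a b \<phi>) \<pi> i E = (SUP j \<in> window \<pi> i a b. rob \<phi> \<pi> j E)"
| "rob (Until a b \<phi> \<psi>) \<pi> i E =
     (SUP j \<in> window \<pi> i a b.
        min (rob \<psi> \<pi> j E)
            (INF k \<in> {k. k < length \<pi> \<and> time \<pi> k \<in> {time \<pi> i ..< time \<pi> j}}. rob \<phi> \<pi> k E))"
| "rob (Freeze k h \<phi>) \<pi> i E = rob \<phi> \<pi> i (E((k, h) := sig \<pi> i $ k))"

text \<open>
  Right-hand side of the equivalence for a negated until, in terms of the negated operands.
\<close>

definition until_dual :: "real \<Rightarrow> real \<Rightarrow> ('d::finite, 'h::finite) stl \<Rightarrow> ('d, 'h) stl \<Rightarrow> ('d, 'h) stl" where
  "until_dual a b n\<phi> n\<psi> = Or (Box a b n\<psi>) (Until a b n\<psi> (And n\<phi> n\<psi>))"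

fun nnf :: "('d::finite, 'h::finite) stl \<Rightarrow> ('d, 'h) stl" where
  "nnf (Pred f c) = Pred f c"
| "nnf (Constr f1 c f2) = Constr f1 c f2"
| "nnf (And \<phi> \<psi>) = And (nnf \<phi>) (nnf \<psi>)"
| "nnf (Or \<phi> \<psi>) = Or (nnf \<phi>) (nnf \<psi>)"
| "nnf (Box a b \<phi>) = Box a b (nnf \<phi>)"
| "nnf (Dia a b \<phi>) = Dia a b (nnf \<phi>)"
| "nnf (Until a b \<phi> \<psi>) = Until a b (nnf \<phi>) (nnf \<psi>)"
| "nnf (Freeze k h \<phi>) = Freeze k h (nnf \<phi>)"
| "nnf (Neg (Pred f c)) = Pred f (cmp_neg c)"
| "nnf (Neg (Constr f1 c f2)) = Constr f1 (cmp_neg c) f2"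
| "nnf (Neg (Neg \<phi>)) = nnf \<phi>"
| "nnf (Neg (And \<phi> \<psi>)) = Or (nnf (Neg \<phi>)) (nnf (Neg \<psi>))"
| "nnf (Neg (Or \<phi> \<psi>)) = And (nnf (Neg \<phi>)) (nnf (Neg \<psi>))"
| "nnf (Neg (Box a b \<phi>)) = Dia a b (nnf (Neg \<phi>))"
| "nnf (Neg (Dia a b \<phi>)) = Box a b (nnf (Neg \<phi>))"
| "nnf (Neg (Until a b \<phi> \<psi>)) = until_dual a b (nnf (Neg \<phi>)) (nnf (Neg \<psi>))"
| "nnf (Neg (Freeze k h \<phi>)) = Freeze k h (nnf (Neg \<phi>))"

text \<open>
  Predicates keep the shape \<open>g(s) c 0\<close>, so \<open>f(s) c r\<close> is written \<open>(f - r)(s) c 0\<close> and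
  \<open>f(s) c -r\<close> is written \<open>(f + r)(s) c 0\<close>. The function is applied to negation-free
  formulas only; its clause for \<open>Neg\<close> plays no role.
\<close>

primrec shift :: "real \<Rightarrow> ('d::finite, 'h::finite) stl \<Rightarrow> ('d, 'h) stl" where
  "shift r (Pred f c) = Pred (\<lambda>x. if is_upper c then f x - r else f x + r) c"
| "shift r (Constr f1 c f2) = Constr f1 c (\<lambda>e. if is_upper c then f2 e + r else f2 e - r)"
| "shift r (Neg \<phi>) = Neg (shift r \<phi>)"
| "shift r (And \<phi> \<psi>) = And (shift r \<phi>) (shift r \<psi>)"
| "shift r (Or \<phi> \<psi>) = Or (shift r \<phi>) (shift r \<psi>)"
| "shift r (Box a b \<phi>) = Box a b (shift r \<phi>)"
| "shift r (Dia a b \<phi>) = Dia a b (shift r \<phi>)"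
| "shift r (Until a b \<phi> \<psi>) = Until a b (shift r \<phi>) (shift r \<psi>)"
| "shift r (Freeze k h \<phi>) = Freeze k h (shift r \<phi>)"

definition transform :: "real \<Rightarrow> ('d::finite, 'h::finite) stl \<Rightarrow> ('d, 'h) stl" where
  "transform r \<phi> = shift r (nnf \<phi>)"

definition stl_equiv :: "('d::finite, 'h::finite) stl \<Rightarrow> ('d, 'h) stl \<Rightarrow> bool" where
  "stl_equiv \<phi> \<psi> \<longleftrightarrow>
     (\<forall>\<pi> i E. is_trace \<pi> \<and> i < length \<pi> \<longrightarrow> sat \<pi> i E \<phi> = sat \<pi> i E \<psi>)"

text \<open>
  The intervals of those untils to which \<open>nnf\<close> applies its rule for a negated until.
\<close>

fun negated_untils :: "('d::finite, 'h::finite) stl \<Rightarrow> (real \<times> real) set" where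
  "negated_untils (Pred f c) = {}"
| "negated_untils (Constr f1 c f2) = {}"
| "negated_untils (And \<phi> \<psi>) = negated_untils \<phi> \<union> negated_untils \<psi>"
| "negated_untils (Or \<phi> \<psi>) = negated_untils \<phi> \<union> negated_untils \<psi>"
| "negated_untils (Box a b \<phi>) = negated_untils \<phi>"
| "negated_untils (Dia a b \<phi>) = negated_untils \<phi>"
| "negated_untils (Until a b \<phi> \<psi>) = negated_untils \<phi> \<union> negated_untils \<psi>"
| "negated_untils (Freeze k h \<phi>) = negated_untils \<phi>"
| "negated_untils (Neg (Pred f c)) = {}"
| "negated_untils (Neg (Constr f1 c f2)) = {}"
| "negated_untils (Neg (Neg \<phi>)) = negated_untils \<phi>"
| "negated_untils (Neg (And \<phi> \<psi>)) = negated_untils (Neg \<phi>) \<union> negated_untils (Neg \<psi>)"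
| "negated_untils (Neg (Or \<phi> \<psi>)) = negated_untils (Neg \<phi>) \<union> negated_untils (Neg \<psi>)"
| "negated_untils (Neg (Box a b \<phi>)) = negated_untils (Neg \<phi>)"
| "negated_untils (Neg (Dia a b \<phi>)) = negated_untils (Neg \<phi>)"
| "negated_untils (Neg (Until a b \<phi> \<psi>)) =
     insert (a, b) (negated_untils (Neg \<phi>) \<union> negated_untils (Neg \<psi>))"
| "negated_untils (Neg (Freeze k h \<phi>)) = negated_untils (Neg \<phi>)"

text \<open>
  The equivalence for a negated until is valid exactly for intervals that start at 0 or are
  empty (\<open>until_dual_valid_iff\<close>): if \<open>0 < a \<le> b\<close>, the first operand may fail before
  the interval is entered while the second operand never fails. The following predicate asks
  for the equivalence, as a schema in the operands, at those intervals where \<open>nnf\<close> uses it.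
\<close>

definition until_dual_valid :: "('d::finite, 'h::finite) stl \<Rightarrow> bool" where
  "until_dual_valid \<phi> \<longleftrightarrow>
     (\<forall>(a, b) \<in> negated_untils \<phi>. \<forall>\<phi>1 \<phi>2 :: ('d, 'h) stl.
        stl_equiv (Neg (Until a b \<phi>1 \<phi>2)) (until_dual a b (Neg \<phi>1) (Neg \<phi>2)))"

lemma is_trace_mono:
  assumes "is_trace \<pi>" "i < length \<pi>" "j < length \<pi>"
  shows "time \<pi> i \<le> time \<pi> j \<longleftrightarrow> i \<le> j" "time \<pi> i < time \<pi> j \<longleftrightarrow> i < j"
proof -
  have "i < j \<Longrightarrow> time \<pi> i < time \<pi> j" "j < i \<Longrightarrow> time \<pi> j < time \<pi> i"
    using assms unfolding is_trace_def by auto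
  then show "time \<pi> i \<le> time \<pi> j \<longleftrightarrow> i \<le> j" "time \<pi> i < time \<pi> j \<longleftrightarrow> i < j"
    by (cases i j rule: linorder_cases; force)+
qed

lemma until_dual_zero:
  assumes "is_trace \<pi>" "i < length \<pi>" "a = 0 \<or> b < a"
  shows "(\<not> sat \<pi> i E (Until a b p q)) = sat \<pi> i E (until_dual a b (Neg p) (Neg q))"
proof (cases "a = 0")
  case False
  then have "window \<pi> i a b = {}" using assms(3) by (auto simp: window_def)
  then show ?thesis by (simp add: until_dual_def)
next
  case True
  note m = is_trace_mono[OF assms(1)]
  have w: "j \<in> window \<pi> i a b \<longleftrightarrow> i \<le> j \<and> j < length \<pi> \<and> time \<pi> j \<le> time \<pi> i + b" for j
    using m(1)[OF assms(2), of j] True by (auto simp: window_def)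
  have down: "k \<in> window \<pi> i a b" if "j \<in> window \<pi> i a b" "i \<le> k" "k \<le> j" for j k
    using that m(1)[of k j] unfolding w by auto
  show ?thesis
  proof
    assume L: "\<not> sat \<pi> i E (Until a b p q)"
    show "sat \<pi> i E (until_dual a b (Neg p) (Neg q))"
    proof (cases "\<exists>j. j \<in> window \<pi> i a b \<and> sat \<pi> j E q")
      case False
      then show ?thesis by (auto simp: until_dual_def)
    next
      case True
      define j where "j = (LEAST j. j \<in> window \<pi> i a b \<and> sat \<pi> j E q)"
      have j: "j \<in> window \<pi> i a b" "sat \<pi> j E q"
        using LeastI_ex[OF True] unfolding j_def by auto
      have lst: "\<not> sat \<pi> k E q" if "i \<le> k" "k < j" for k
        using not_less_Least[of k "\<lambda>j. j \<in> window \<pi> i a b \<and> sat \<pi> j E q"] that down[OF j(1)]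
        unfolding j_def[symmetric] by auto
      obtain k where k: "i \<le> k" "k < j" "\<not> sat \<pi> k E p"
        using L j w by auto
      have "k \<in> window \<pi> i a b" using down[OF j(1)] k by auto
      then have "sat \<pi> i E (Until a b (Neg q) (And (Neg p) (Neg q)))"
        using k lst by (auto intro!: bexI[of _ k])
      then show ?thesis by (simp add: until_dual_def)
    qed
  next
    assume "sat \<pi> i E (until_dual a b (Neg p) (Neg q))"
    then show "\<not> sat \<pi> i E (Until a b p q)"
      by (auto simp: until_dual_def w) (metis linorder_neqE_nat)
  qed
qed

lemma until_dual_valid_iff:
  assumes "0 \<le> a"
  shows "(\<forall>\<phi>1 \<phi>2 :: ('d::finite, 'h::finite) stl.
            stl_equiv (Neg (Until a b \<phi>1 \<phi>2)) (until_dual a b (Neg \<phi>1) (Neg \<phi>2)))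
         \<longleftrightarrow> a = 0 \<or> b < a"
proof
  assume "a = 0 \<or> b < a"
  then show "\<forall>\<phi>1 \<phi>2 :: ('d, 'h) stl.
            stl_equiv (Neg (Until a b \<phi>1 \<phi>2)) (until_dual a b (Neg \<phi>1) (Neg \<phi>2))"
    unfolding stl_equiv_def using until_dual_zero by fastforce
next
  assume A: "\<forall>\<phi>1 \<phi>2 :: ('d, 'h) stl.
            stl_equiv (Neg (Until a b \<phi>1 \<phi>2)) (until_dual a b (Neg \<phi>1) (Neg \<phi>2))"
  show "a = 0 \<or> b < a"
  proof (rule ccontr)
    assume "\<not> (a = 0 \<or> b < a)"
    then have ab: "0 < a" "a \<le> b" using assms by auto
    define p q :: "('d, 'h) stl" where "p = Pred (\<lambda>_. -1) Gt" and "q = Pred (\<lambda>_. 1) Gt"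
    define \<pi> :: "'d trace" where "\<pi> = [(0, 0), (0, a)]"
    have t: "time \<pi> 0 = 0" "time \<pi> (Suc 0) = a" "length \<pi> = 2"
      by (auto simp: \<pi>_def time_def)
    have tr: "is_trace \<pi>"
      using ab by (auto simp: is_trace_def t less_2_cases_iff)
    have w: "window \<pi> 0 a b = {1}"
      using ab by (auto simp: window_def t less_2_cases_iff)
    have sp: "\<And>k E. \<not> sat \<pi> k E p" and sq: "\<And>k E. sat \<pi> k E q"
      by (auto simp: p_def q_def)
    have "\<not> sat \<pi> 0 E (Until a b p q)"  for E
      using sp by (auto simp: w)
    moreover have "\<not> sat \<pi> 0 E (until_dual a b (Neg p) (Neg q))" for E
      using sq by (auto simp: until_dual_def w)
    moreover have "sat \<pi> 0 E (Neg (Until a b p q)) = sat \<pi> 0 E (until_dual a b (Neg p) (Neg q))"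
      for E
      using A[rule_format, of p q] tr t unfolding stl_equiv_def by (metis zero_less_numeral)
    ultimately show False
      by (metis sat.simps(3))
  qed
qed

end

theory Submission
  imports Defs
begin

text \<open>
  Induction along the negation normal form. Since every window lies in the future, the rule for a
  negated until is sound for the lower bound on every interval. For the upper bound take the first
  position \<open>j\<close> at which the transformed negated second operand fails. On an interval that
  starts at 0 all positions between the current one and \<open>j\<close> belong to the window, so the
  transformed negated first operand fails at each of them; hence \<open>j\<close> witnesses the robustness
  of the until.
\<close>

text \<open>Arithmetic substitute for \<open>until_dual_valid\<close>: it splits over unions, so the
  induction can hand it down to subformulas.\<close>

definition start_zero_or_empty :: "(real \<times> real) set \<Rightarrow> bool" where
  "start_zero_or_empty A \<longleftrightarrow> (\<forall>(a, b) \<in> A. a = 0 \<or> b < a)"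

lemma start_zero_or_empty_simps [simp]:
  "start_zero_or_empty {}"
  "start_zero_or_empty (A \<union> B) \<longleftrightarrow> start_zero_or_empty A \<and> start_zero_or_empty B"
  "start_zero_or_empty (insert (a, b) A) \<longleftrightarrow> (a = 0 \<or> b < a) \<and> start_zero_or_empty A"
  by (auto simp: start_zero_or_empty_def)

lemma negated_untils_start_nonneg:
  "wf_stl \<phi> \<Longrightarrow> (a, b) \<in> negated_untils \<phi> \<Longrightarrow> 0 \<le> a"
  by (induction \<phi> rule: negated_untils.induct) auto

text \<open>Pointwise use of \<open>until_dual_valid_iff\<close>; its premise
  \<open>0 \<le> a\<close> comes from well-formedness.\<close>

lemma until_dual_valid_start_zero_or_empty:
  fixes \<phi> :: "('d::finite, 'h::finite) stl"
  assumes "wf_stl \<phi>" "until_dual_valid \<phi>"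
  shows "start_zero_or_empty (negated_untils \<phi>)"
  using assms negated_untils_start_nonneg[OF assms(1)]
    until_dual_valid_iff[where ?'d = 'd and ?'h = 'h]
  unfolding until_dual_valid_def start_zero_or_empty_def by blast

lemma window_length: "j \<in> window \<pi> i a b \<Longrightarrow> j < length \<pi>"
  by (simp add: window_def)

lemma window_ge:
  assumes "is_trace \<pi>" "i < length \<pi>" "0 \<le> a" "j \<in> window \<pi> i a b"
  shows "i \<le> j"
  using assms is_trace_mono(1)[of \<pi> i j] by (auto simp: window_def)

text \<open>With left end point 0 the lower time bound is just \<open>i \<le> k\<close>, and the
  upper one is inherited from \<open>j\<close>.\<close>

lemma window_zero_downward:
  assumes "is_trace \<pi>" "i \<le> k" "k \<le> j" "j \<in> window \<pi> i 0 b"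
  shows "k \<in> window \<pi> i 0 b"
  using assms is_trace_mono(1)[of \<pi> i k] is_trace_mono(1)[of \<pi> k j]
  by (auto simp: window_def)

text \<open>Timestamps increase strictly. This reconciles the robustness of until, indexed by times,
  with its Boolean semantics, indexed by positions.\<close>

lemma time_interval_eq:
  assumes "is_trace \<pi>" "i < length \<pi>" "j < length \<pi>"
  shows "{k. k < length \<pi> \<and> time \<pi> k \<in> {time \<pi> i ..< time \<pi> j}} = {i..<j}"
  using assms is_trace_mono[OF assms(1)] by auto

lemma rob_Until:
  assumes "is_trace \<pi>" "i < length \<pi>"
  shows "rob (Until a b p q) \<pi> i E =
    (SUP j \<in> window \<pi> i a b. min (rob q \<pi> j E) (INF k \<in> {i..<j}. rob p \<pi> k E))"
  unfolding rob.simps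
  by (intro SUP_cong refl) (simp only: time_interval_eq[OF assms window_length])

text \<open>Together with \<open>rob_Until_le\<close> this replaces suprema and infima by witnesses.
  For an empty range of \<open>k\<close> the infimum is \<open>\<infinity>\<close> and does not
  affect the minimum.\<close>

lemma rob_Until_ge:
  assumes "is_trace \<pi>" "i < length \<pi>" "j \<in> window \<pi> i a b" "c \<le> rob q \<pi> j E"
    and "\<And>k. i \<le> k \<Longrightarrow> k < j \<Longrightarrow> c \<le> rob p \<pi> k E"
  shows "c \<le> rob (Until a b p q) \<pi> i E"
  unfolding rob_Until[OF assms(1,2)]
  using assms(3-5) by (intro SUP_upper2[where i = j]) (auto intro: INF_greatest)

lemma rob_Until_le:
  assumes "is_trace \<pi>" "i < length \<pi>"
    and "\<And>j. j \<in> window \<pi> i a b \<Longrightarrow>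
           rob q \<pi> j E \<le> c \<or> (\<exists>k. i \<le> k \<and> k < j \<and> rob p \<pi> k E \<le> c)"
  shows "rob (Until a b p q) \<pi> i E \<le> c"
  unfolding rob_Until[OF assms(1,2)]
proof (rule SUP_least)
  fix j assume "j \<in> window \<pi> i a b"
  from assms(3)[OF this]
  show "min (rob q \<pi> j E) (INF k \<in> {i..<j}. rob p \<pi> k E) \<le> c"
    by (auto simp: min_le_iff_disj intro: INF_lower2)
qed

text \<open>Turns a hypothesis on a negated operand with threshold \<open>r\<close> into one on the
  operand itself with threshold \<open>- r\<close>.\<close>

lemma ereal_uminus_bounds:
  "ereal r \<le> - x \<longleftrightarrow> x \<le> ereal (- r)" "- x \<le> ereal r \<longleftrightarrow> ereal (- r) \<le> x"
  by (cases x; auto)+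

text \<open>The induction follows the recursion of \<open>nnf\<close>, so the hypotheses in the
  negated cases concern negated operands and \<open>r\<close> stays fixed. \<open>i\<close> and
  \<open>E\<close> vary because temporal operators move the position and freezes update the
  environment.\<close>

lemma rob_bounds_transform:
  fixes \<phi> :: "('d::finite, 'h::finite) stl"
  assumes "is_trace \<pi>" "wf_stl \<phi>" "i < length \<pi>"
  shows "(sat \<pi> i E (shift r (nnf \<phi>)) \<longrightarrow> ereal r \<le> rob \<phi> \<pi> i E) \<and>
         (start_zero_or_empty (negated_untils \<phi>) \<longrightarrow> \<not> sat \<pi> i E (shift r (nnf \<phi>)) \<longrightarrow>
            rob \<phi> \<pi> i E \<le> ereal r)"
  using assms(2,3)
proof (induction \<phi> arbitrary: i E rule: nnf.induct)
  case (1 f c)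
  then show ?case by (cases c) (auto simp: is_upper_def)
next
  case (2 f1 c f2)
  then show ?case by (cases c) (auto simp: is_upper_def)
next
  case (3 p q)
  then show ?case by (fastforce simp: min_le_iff_disj)
next
  case (4 p q)
  then show ?case by (fastforce simp: le_max_iff_disj)
next
  case (5 a b p)
  then show ?case by (auto intro!: INF_greatest intro: INF_lower2 dest: window_length)
next
  case (6 a b p)
  then show ?case by (auto intro!: SUP_least intro: SUP_upper2 dest: window_length)
next
  case (7 a b p q)
  note tr = assms(1) 7(4)
  have wf: "wf_stl p" "wf_stl q" "0 \<le> a" using 7(3) by auto
  show ?case
  proof (intro conjI impI)
    assume "sat \<pi> i E (shift r (nnf (Until a b p q)))"
    then obtain j where j: "j \<in> window \<pi> i a b" "sat \<pi> j E (shift r (nnf q))"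
      "\<And>k. i \<le> k \<Longrightarrow> k < j \<Longrightarrow> sat \<pi> k E (shift r (nnf p))" by auto
    with 7(1,2) wf window_length[OF j(1)] show "ereal r \<le> rob (Until a b p q) \<pi> i E"
      by (intro rob_Until_ge[OF tr j(1)]) auto
  next
    assume z: "start_zero_or_empty (negated_untils (Until a b p q))"
      and n: "\<not> sat \<pi> i E (shift r (nnf (Until a b p q)))"
    show "rob (Until a b p q) \<pi> i E \<le> ereal r"
    proof (rule rob_Until_le[OF tr])
      fix j assume j: "j \<in> window \<pi> i a b"
      \<comment> \<open>The Boolean until demands \<open>i \<le> j\<close>, the supremum does not;
        \<open>window_ge\<close> closes this gap.\<close>
      then have "\<not> sat \<pi> j E (shift r (nnf q)) \<or> (\<exists>k\<ge>i. k < j \<and> \<not> sat \<pi> k E (shift r (nnf p)))"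
        using n window_ge[OF tr wf(3) j] by auto
      then show "rob q \<pi> j E \<le> ereal r \<or> (\<exists>k. i \<le> k \<and> k < j \<and> rob p \<pi> k E \<le> ereal r)"
        using 7(1)[OF wf(1)] 7(2)[OF wf(2)] z window_length[OF j]
        by (metis less_trans negated_untils.simps(7) start_zero_or_empty_simps(2))
    qed
  qed
next
  case (8 k h p)
  then show ?case by auto
next
  case (9 f c)
  \<comment> \<open>\<open>cmp_neg\<close> also flips \<open>is_upper\<close>, so the shift changes
    sign along with the robustness.\<close>
  then show ?case by (cases c) (auto simp: is_upper_def)
next
  case (10 f1 c f2)
  then show ?case by (cases c) (auto simp: is_upper_def)
next
  case (11 p)
  then show ?case by auto
next
  case (12 p q)
  then show ?case by (fastforce simp: min_le_iff_disj le_max_iff_disj ereal_uminus_bounds)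
next
  case (13 p q)
  then show ?case by (fastforce simp: min_le_iff_disj le_max_iff_disj ereal_uminus_bounds)
next
  case (14 a b p)
  then show ?case
    by (auto simp: ereal_uminus_bounds simp del: uminus_ereal.simps
        intro!: INF_greatest intro: INF_lower2 dest: window_length)
next
  case (15 a b p)
  then show ?case
    by (auto simp: ereal_uminus_bounds simp del: uminus_ereal.simps
        intro!: SUP_least intro: SUP_upper2 dest: window_length)
next
  case (16 a b p q)
  note tr = assms(1) 16(4)
  let ?p = "\<lambda>k. sat \<pi> k E (shift r (nnf (Neg p)))"
  let ?q = "\<lambda>k. sat \<pi> k E (shift r (nnf (Neg q)))"
  have a: "0 \<le> a" using 16(3) by simp
  have p: "?p k \<Longrightarrow> rob p \<pi> k E \<le> ereal (- r)"
    and q: "?q k \<Longrightarrow> rob q \<pi> k E \<le> ereal (- r)" if "k < length \<pi>" for k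
    using 16(1)[of k E] 16(2)[of k E] 16(3) that by (auto simp: ereal_uminus_bounds)
  have sat_iff: "sat \<pi> i E (shift r (nnf (Neg (Until a b p q)))) \<longleftrightarrow>
      (\<forall>j \<in> window \<pi> i a b. ?q j) \<or>
      (\<exists>j \<in> window \<pi> i a b. i \<le> j \<and> ?p j \<and> ?q j \<and> (\<forall>k. i \<le> k \<and> k < j \<longrightarrow> ?q k))"
    by (simp add: until_dual_def conj_assoc)
  show ?case
  proof (intro conjI impI)
    assume s: "sat \<pi> i E (shift r (nnf (Neg (Until a b p q))))"
    have "rob (Until a b p q) \<pi> i E \<le> ereal (- r)"
    proof (rule rob_Until_le[OF tr])
      fix j assume j: "j \<in> window \<pi> i a b"
      \<comment> \<open>If \<open>?q j\<close> fails, the box disjunct fails and the until disjunct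
        has a witness \<open>l\<close>. As \<open>?q\<close> holds from \<open>i\<close> up to and
        including \<open>l\<close>, and \<open>i \<le> j\<close>, this forces
        \<open>l < j\<close>.\<close>
      consider "?q j" | l where "i \<le> l" "l < j" "?p l"
        using s j window_ge[OF tr a j] unfolding sat_iff by (metis linorder_neqE_nat)
      then show "rob q \<pi> j E \<le> ereal (- r) \<or> (\<exists>k. i \<le> k \<and> k < j \<and> rob p \<pi> k E \<le> ereal (- r))"
        using p q window_length[OF j] by cases (auto dest: less_trans)
    qed
    then show "ereal r \<le> rob (Neg (Until a b p q)) \<pi> i E"
      by (simp add: ereal_uminus_bounds del: uminus_ereal.simps rob.simps(8))
  next
    assume z: "start_zero_or_empty (negated_untils (Neg (Until a b p q)))"
      and n: "\<not> sat \<pi> i E (shift r (nnf (Neg (Until a b p q))))"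
    have p': "\<not> ?p k \<Longrightarrow> ereal (- r) \<le> rob p \<pi> k E"
      and q': "\<not> ?q k \<Longrightarrow> ereal (- r) \<le> rob q \<pi> k E" if "k < length \<pi>" for k
      using 16(1)[of k E] 16(2)[of k E] 16(3) z that by (auto simp: ereal_uminus_bounds)
    from n have ex: "\<exists>j. j \<in> window \<pi> i a b \<and> \<not> ?q j" unfolding sat_iff by auto
    \<comment> \<open>The window contains a position, which rules out \<open>b < a\<close>.\<close>
    then have "a = 0" using z by (auto simp: window_def)
    define j where "j = (LEAST j. j \<in> window \<pi> i a b \<and> \<not> ?q j)"
    have j: "j \<in> window \<pi> i a b" "\<not> ?q j"
      using LeastI_ex[OF ex] unfolding j_def by auto
    have before: "k \<in> window \<pi> i a b" "?q k" if "i \<le> k" "k < j" for k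
    proof -
      show w: "k \<in> window \<pi> i a b"
        using window_zero_downward[OF assms(1) that(1) less_imp_le[OF that(2)]] j(1) \<open>a = 0\<close> by auto
      show "?q k" using not_less_Least[OF that(2)[unfolded j_def]] w by auto
    qed
    \<comment> \<open>Otherwise \<open>k\<close> itself would witness the until disjunct: it lies in
      the window and \<open>?q\<close> holds from \<open>i\<close> through \<open>k\<close>.\<close>
    have "\<not> ?p k" if "i \<le> k" "k < j" for k
      using n before that unfolding sat_iff by (meson less_trans)
    then have "ereal (- r) \<le> rob (Until a b p q) \<pi> i E"
      using p' q' j window_length[OF j(1)] by (intro rob_Until_ge[OF tr j(1)]) auto
    then show "rob (Neg (Until a b p q)) \<pi> i E \<le> ereal r"
      by (simp add: ereal_uminus_bounds del: uminus_ereal.simps rob.simps(8))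
  qed
next
  case (17 k h p)
  then show ?case by auto
qed

theorem theorem2:
  fixes \<pi> :: "('d::finite) trace"
    and \<phi> :: "('d, 'h::finite) stl"
    and E :: "('d, 'h) env"
    and i :: nat and r :: real
  assumes "is_trace \<pi>" and "wf_stl \<phi>" and "i < length \<pi>"
  shows "(sat \<pi> i E (transform r \<phi>) \<longrightarrow> rob \<phi> \<pi> i E \<ge> ereal r) \<and>
         (until_dual_valid \<phi> \<longrightarrow> \<not> sat \<pi> i E (transform r \<phi>) \<longrightarrow> rob \<phi> \<pi> i E \<le> ereal r)"
  using rob_bounds_transform[OF assms] until_dual_valid_start_zero_or_empty[OF assms(2)]
  unfolding transform_def by blast

end
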